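(* There is a computable map assigning to every sentence $\varphi$ of second order intuitionistic propositional logic $\mathrm{IPC}2$ a sentence $\varphi^{\dagger}$ of monadic second order logic in the signature $(s_0,s_1,\leq)$ such that $\varphi$ is true in the topology $\mathcal{O}(\mathbb{R})$ of open subsets of the reals if and only if $\mathcal{T}^\omega\models\varphi^{\dagger}$. Likewise, there is a computable map $\varphi\mapsto\varphi^{\ddagger}$ such that $\varphi$ is true in the topology $\mathcal{O}(\mathbb{Q})$ of open subsets of the rationals if and only if $\mathcal{T}^\omega\models\varphi^{\ddagger}$. That is, the $\mathrm{IPC}2$ theories of $\mathcal{O}(\mathbb{R})$ and of $\mathcal{O}(\mathbb{Q})$ are interpretable in $\mathrm{S2S}$, the monadic second order theory of $\mathcal{T}^\omega$.
   Context: Formulas of $\mathrm{IPC}2$ are built from propositional variables and $\bot$ using $\land,\lor,\Rightarrow$ and quantifiers $\forall p,\exists p$ over propositional variables; $\neg\varphi$ abbreviates $\varphi\Rightarrow\bot$. Principal topological semantics: for a topological space $T$ with set of open sets $\mathcal{O}(T)$ and a valuation $v$ mapping propositional variables to open sets, define $\llbracket\bot\rrbracket_v=\emptyset$, $\llbracket p\rrbracket_v=v(p)$, $\llbracket\psi\land\gamma\rrbracket_v=\llbracket\psi\rrbracket_v\cap\llbracket\gamma\rrbracket_v$, $\llbracket\psi\lor\gamma\rrbracket_v=\llbracket\psi\rrbracket_v\cup\llbracket\gamma\rrbracket_v$, $\llbracket\psi\Rightarrow\gamma\rrbracket_v=\mathrm{int}((T\setminus\llbracket\psi\rrbracket_v)\cup\llbracket\gamma\rrbracket_v)$,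 $\llbracket\exists p\,\psi\rrbracket_v=\bigcup_{a\in\mathcal{O}(T)}\llbracket\psi\rrbracket_{v(p\mapsto a)}$, $\llbracket\forall p\,\psi\rrbracket_v=\mathrm{int}\big(\bigcap_{a\in\mathcal{O}(T)}\llbracket\psi\rrbracket_{v(p\mapsto a)}\big)$. A sentence $\varphi$ is true in $T$ if $\llbracket\varphi\rrbracket_v=T$ (this does not depend on $v$ for sentences). The infinite binary tree is $\mathcal{T}^\omega=(\{0,1\}^*,s_0,s_1,\leq)$ where $s_0(u)=u0$, $s_1(u)=u1$, and $u\leq w$ iff $u$ is an initial segment of $w$; monadic second order logic extends first order logic with quantification over subsets of the universe. *)

theory Defs
  imports "HOL-Analysis.Analysis" "HOL-Library.Sublist" "HOL-Library.Nat_Bijection"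
begin

section \<open>Second order intuitionistic propositional logic\<close>

datatype ipc2 =
    IVar nat
  | IBot
  | IAnd ipc2 ipc2
  | IOr ipc2 ipc2
  | IImp ipc2 ipc2
  | IAll nat ipc2
  | IEx nat ipc2

abbreviation INeg :: "ipc2 \<Rightarrow> ipc2" where
  "INeg \<phi> \<equiv> IImp \<phi> IBot"

primrec ipc2_fv :: "ipc2 \<Rightarrow> nat set" where
  "ipc2_fv (IVar p) = {p}"
| "ipc2_fv IBot = {}"
| "ipc2_fv (IAnd \<psi> \<gamma>) = ipc2_fv \<psi> \<union> ipc2_fv \<gamma>"
| "ipc2_fv (IOr \<psi> \<gamma>) = ipc2_fv \<psi> \<union> ipc2_fv \<gamma>"
| "ipc2_fv (IImp \<psi> \<gamma>) = ipc2_fv \<psi> \<union> ipc2_fv \<gamma>"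
| "ipc2_fv (IAll p \<psi>) = ipc2_fv \<psi> - {p}"
| "ipc2_fv (IEx p \<psi>) = ipc2_fv \<psi> - {p}"

definition ipc2_sentence :: "ipc2 \<Rightarrow> bool" where
  "ipc2_sentence \<phi> \<longleftrightarrow> ipc2_fv \<phi> = {}"

primrec ipc2_val :: "'a topology \<Rightarrow> (nat \<Rightarrow> 'a set) \<Rightarrow> ipc2 \<Rightarrow> 'a set" where
  "ipc2_val T v (IVar p) = v p"
| "ipc2_val T v IBot = {}"
| "ipc2_val T v (IAnd \<psi> \<gamma>) = ipc2_val T v \<psi> \<inter> ipc2_val T v \<gamma>"
| "ipc2_val T v (IOr \<psi> \<gamma>) = ipc2_val T v \<psi> \<union> ipc2_val T v \<gamma>"
| "ipc2_val T v (IImp \<psi> \<gamma>) =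
     T interior_of ((topspace T - ipc2_val T v \<psi>) \<union> ipc2_val T v \<gamma>)"
| "ipc2_val T v (IAll p \<psi>) =
     T interior_of (\<Inter>a\<in>{a. openin T a}. ipc2_val T (v(p := a)) \<psi>)"
| "ipc2_val T v (IEx p \<psi>) = (\<Union>a\<in>{a. openin T a}. ipc2_val T (v(p := a)) \<psi>)"

definition ipc2_true_in :: "'a topology \<Rightarrow> ipc2 \<Rightarrow> bool" where
  "ipc2_true_in T \<phi> \<longleftrightarrow>
     (\<forall>v. (\<forall>p. openin T (v p)) \<longrightarrow> ipc2_val T v \<phi> = topspace T)"

lemma ipc2_val_cong:
  "(\<And>p. p \<in> ipc2_fv \<phi> \<Longrightarrow> v p = w p) \<Longrightarrow> ipc2_val T v \<phi> = ipc2_val T w \<phi>"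
proof (induction \<phi> arbitrary: v w)
  case (IAll p \<psi>)
  have "ipc2_val T (v(p := a)) \<psi> = ipc2_val T (w(p := a)) \<psi>" for a
    by (rule IAll.IH) (use IAll.prems in auto)
  then show ?case by simp
next
  case (IEx p \<psi>)
  have "ipc2_val T (v(p := a)) \<psi> = ipc2_val T (w(p := a)) \<psi>" for a
    by (rule IEx.IH) (use IEx.prems in auto)
  then show ?case by simp
next
  case (IAnd \<psi> \<gamma>)
  then have "ipc2_val T v \<psi> = ipc2_val T w \<psi>" "ipc2_val T v \<gamma> = ipc2_val T w \<gamma>"
    by (metis UnCI ipc2_fv.simps)+
  then show ?case by simp
next
  case (IOr \<psi> \<gamma>)
  then have "ipc2_val T v \<psi> = ipc2_val T w \<psi>" "ipc2_val T v \<gamma> = ipc2_val T w \<gamma>"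
    by (metis UnCI ipc2_fv.simps)+
  then show ?case by simp
next
  case (IImp \<psi> \<gamma>)
  then have "ipc2_val T v \<psi> = ipc2_val T w \<psi>" "ipc2_val T v \<gamma> = ipc2_val T w \<gamma>"
    by (metis UnCI ipc2_fv.simps)+
  then show ?case by simp
qed auto

lemma ipc2_true_in_sentence:
  assumes "ipc2_sentence \<phi>"
  shows "ipc2_true_in T \<phi> \<longleftrightarrow> ipc2_val T v \<phi> = topspace T"
proof -
  have "ipc2_val T w \<phi> = ipc2_val T v \<phi>" for w
    using assms by (intro ipc2_val_cong) (simp add: ipc2_sentence_def)
  moreover have "\<exists>w::nat \<Rightarrow> 'a set. \<forall>p. openin T (w p)"
    by (intro exI[of _ "\<lambda>_. {}"]) simp
  ultimately show ?thesis
    unfolding ipc2_true_in_def by metis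
qed


section \<open>Monadic second order logic in the signature \<open>(s\<^sub>0, s\<^sub>1, \<le>)\<close>\<close>

datatype mso_term =
    TVar nat
  | TS0 mso_term
  | TS1 mso_term

text \<open>Element variables and set variables are two separate sorts, each named by
  natural numbers: \<open>MAll1\<close>, \<open>MEx1\<close> bind the former and \<open>MAll2\<close>, \<open>MEx2\<close> the latter.\<close>

datatype mso =
    MEq mso_term mso_term
  | MLeq mso_term mso_term
  | MMem mso_term nat
  | MNot mso
  | MAnd mso mso
  | MOr mso mso
  | MImp mso mso
  | MAll1 nat mso
  | MEx1 nat mso
  | MAll2 nat mso
  | MEx2 nat mso

primrec term_fv :: "mso_term \<Rightarrow> nat set" where
  "term_fv (TVar x) = {x}"
| "term_fv (TS0 t) = term_fv t"
| "term_fv (TS1 t) = term_fv t"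

primrec mso_fv1 :: "mso \<Rightarrow> nat set" where
  "mso_fv1 (MEq s t) = term_fv s \<union> term_fv t"
| "mso_fv1 (MLeq s t) = term_fv s \<union> term_fv t"
| "mso_fv1 (MMem t X) = term_fv t"
| "mso_fv1 (MNot \<alpha>) = mso_fv1 \<alpha>"
| "mso_fv1 (MAnd \<alpha> \<beta>) = mso_fv1 \<alpha> \<union> mso_fv1 \<beta>"
| "mso_fv1 (MOr \<alpha> \<beta>) = mso_fv1 \<alpha> \<union> mso_fv1 \<beta>"
| "mso_fv1 (MImp \<alpha> \<beta>) = mso_fv1 \<alpha> \<union> mso_fv1 \<beta>"
| "mso_fv1 (MAll1 x \<alpha>) = mso_fv1 \<alpha> - {x}"
| "mso_fv1 (MEx1 x \<alpha>) = mso_fv1 \<alpha> - {x}"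
| "mso_fv1 (MAll2 X \<alpha>) = mso_fv1 \<alpha>"
| "mso_fv1 (MEx2 X \<alpha>) = mso_fv1 \<alpha>"

primrec mso_fv2 :: "mso \<Rightarrow> nat set" where
  "mso_fv2 (MEq s t) = {}"
| "mso_fv2 (MLeq s t) = {}"
| "mso_fv2 (MMem t X) = {X}"
| "mso_fv2 (MNot \<alpha>) = mso_fv2 \<alpha>"
| "mso_fv2 (MAnd \<alpha> \<beta>) = mso_fv2 \<alpha> \<union> mso_fv2 \<beta>"
| "mso_fv2 (MOr \<alpha> \<beta>) = mso_fv2 \<alpha> \<union> mso_fv2 \<beta>"
| "mso_fv2 (MImp \<alpha> \<beta>) = mso_fv2 \<alpha> \<union> mso_fv2 \<beta>"
| "mso_fv2 (MAll1 x \<alpha>) = mso_fv2 \<alpha>"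
| "mso_fv2 (MEx1 x \<alpha>) = mso_fv2 \<alpha>"
| "mso_fv2 (MAll2 X \<alpha>) = mso_fv2 \<alpha> - {X}"
| "mso_fv2 (MEx2 X \<alpha>) = mso_fv2 \<alpha> - {X}"

definition mso_sentence :: "mso \<Rightarrow> bool" where
  "mso_sentence \<alpha> \<longleftrightarrow> mso_fv1 \<alpha> = {} \<and> mso_fv2 \<alpha> = {}"

record 'a mso_struct =
  succ0 :: "'a \<Rightarrow> 'a"
  succ1 :: "'a \<Rightarrow> 'a"
  leq :: "'a \<Rightarrow> 'a \<Rightarrow> bool"

primrec term_val :: "'a mso_struct \<Rightarrow> (nat \<Rightarrow> 'a) \<Rightarrow> mso_term \<Rightarrow> 'a" where
  "term_val M e (TVar x) = e x"
| "term_val M e (TS0 t) = succ0 M (term_val M e t)"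
| "term_val M e (TS1 t) = succ1 M (term_val M e t)"

primrec mso_sat :: "'a mso_struct \<Rightarrow> (nat \<Rightarrow> 'a) \<Rightarrow> (nat \<Rightarrow> 'a set) \<Rightarrow> mso \<Rightarrow> bool" where
  "mso_sat M e E (MEq s t) \<longleftrightarrow> term_val M e s = term_val M e t"
| "mso_sat M e E (MLeq s t) \<longleftrightarrow> leq M (term_val M e s) (term_val M e t)"
| "mso_sat M e E (MMem t X) \<longleftrightarrow> term_val M e t \<in> E X"
| "mso_sat M e E (MNot \<alpha>) \<longleftrightarrow> \<not> mso_sat M e E \<alpha>"
| "mso_sat M e E (MAnd \<alpha> \<beta>) \<longleftrightarrow> mso_sat M e E \<alpha> \<and> mso_sat M e E \<beta>"
| "mso_sat M e E (MOr \<alpha> \<beta>) \<longleftrightarrow> mso_sat M e E \<alpha> \<or> mso_sat M e E \<beta>"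
| "mso_sat M e E (MImp \<alpha> \<beta>) \<longleftrightarrow> (mso_sat M e E \<alpha> \<longrightarrow> mso_sat M e E \<beta>)"
| "mso_sat M e E (MAll1 x \<alpha>) \<longleftrightarrow> (\<forall>a. mso_sat M (e(x := a)) E \<alpha>)"
| "mso_sat M e E (MEx1 x \<alpha>) \<longleftrightarrow> (\<exists>a. mso_sat M (e(x := a)) E \<alpha>)"
| "mso_sat M e E (MAll2 X \<alpha>) \<longleftrightarrow> (\<forall>A. mso_sat M e (E(X := A)) \<alpha>)"
| "mso_sat M e E (MEx2 X \<alpha>) \<longleftrightarrow> (\<exists>A. mso_sat M e (E(X := A)) \<alpha>)"

definition mso_models :: "'a mso_struct \<Rightarrow> mso \<Rightarrow> bool" where
  "mso_models M \<alpha> \<longleftrightarrow> (\<forall>e E. mso_sat M e E \<alpha>)"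

text \<open>Words over \<open>{0, 1}\<close> are lists of booleans, with \<open>False\<close> for \<open>0\<close> and \<open>True\<close> for \<open>1\<close>.\<close>

definition binary_tree :: "bool list mso_struct" where
  "binary_tree =
     \<lparr>succ0 = (\<lambda>u. u @ [False]), succ1 = (\<lambda>u. u @ [True]), leq = prefix\<rparr>"


section \<open>Computable maps\<close>

text \<open>\<open>general_recursive n f\<close>: the values of \<open>f\<close> on lists of length \<open>n\<close> form an \<open>n\<close>-ary
  general recursive function; values on lists of any other length are irrelevant.  Minimization
  is only allowed when it yields a total function, so by Kleene's normal form theorem these
  are exactly the total mu-recursive functions.\<close>

inductive general_recursive :: "nat \<Rightarrow> (nat list \<Rightarrow> nat) \<Rightarrow> bool" where
  zero: "general_recursive n (\<lambda>_. 0)"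
| succ: "general_recursive 1 (\<lambda>xs. Suc (xs ! 0))"
| proj: "i < n \<Longrightarrow> general_recursive n (\<lambda>xs. xs ! i)"
| comp: "general_recursive (length gs) f \<Longrightarrow> (\<forall>g\<in>set gs. general_recursive n g) \<Longrightarrow>
    general_recursive n (\<lambda>xs. f (map (\<lambda>g. g xs) gs))"
| prim_rec: "general_recursive n f \<Longrightarrow> general_recursive (n + 2) g \<Longrightarrow>
    general_recursive (n + 1)
      (\<lambda>xs. rec_nat (f (tl xs)) (\<lambda>k r. g (k # r # tl xs)) (hd xs))"
| minimize: "general_recursive (n + 1) f \<Longrightarrow>
    (\<forall>xs. length xs = n \<longrightarrow> (\<exists>y. f (y # xs) = 0)) \<Longrightarrow>
    general_recursive n (\<lambda>xs. LEAST y. f (y # xs) = 0)"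

definition computable_nat :: "(nat \<Rightarrow> nat) \<Rightarrow> bool" where
  "computable_nat F \<longleftrightarrow> (\<exists>f. general_recursive 1 f \<and> (\<forall>x. F x = f [x]))"

primrec ipc2_code :: "ipc2 \<Rightarrow> nat" where
  "ipc2_code (IVar p) = prod_encode (0, p)"
| "ipc2_code IBot = prod_encode (1, 0)"
| "ipc2_code (IAnd \<psi> \<gamma>) = prod_encode (2, prod_encode (ipc2_code \<psi>, ipc2_code \<gamma>))"
| "ipc2_code (IOr \<psi> \<gamma>) = prod_encode (3, prod_encode (ipc2_code \<psi>, ipc2_code \<gamma>))"
| "ipc2_code (IImp \<psi> \<gamma>) = prod_encode (4, prod_encode (ipc2_code \<psi>, ipc2_code \<gamma>))"
| "ipc2_code (IAll p \<psi>) = prod_encode (5, prod_encode (p, ipc2_code \<psi>))"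
| "ipc2_code (IEx p \<psi>) = prod_encode (6, prod_encode (p, ipc2_code \<psi>))"

primrec term_code :: "mso_term \<Rightarrow> nat" where
  "term_code (TVar x) = prod_encode (0, x)"
| "term_code (TS0 t) = prod_encode (1, term_code t)"
| "term_code (TS1 t) = prod_encode (2, term_code t)"

primrec mso_code :: "mso \<Rightarrow> nat" where
  "mso_code (MEq s t) = prod_encode (0, prod_encode (term_code s, term_code t))"
| "mso_code (MLeq s t) = prod_encode (1, prod_encode (term_code s, term_code t))"
| "mso_code (MMem t X) = prod_encode (2, prod_encode (term_code t, X))"
| "mso_code (MNot \<alpha>) = prod_encode (3, mso_code \<alpha>)"
| "mso_code (MAnd \<alpha> \<beta>) = prod_encode (4, prod_encode (mso_code \<alpha>, mso_code \<beta>))"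
| "mso_code (MOr \<alpha> \<beta>) = prod_encode (5, prod_encode (mso_code \<alpha>, mso_code \<beta>))"
| "mso_code (MImp \<alpha> \<beta>) = prod_encode (6, prod_encode (mso_code \<alpha>, mso_code \<beta>))"
| "mso_code (MAll1 x \<alpha>) = prod_encode (7, prod_encode (x, mso_code \<alpha>))"
| "mso_code (MEx1 x \<alpha>) = prod_encode (8, prod_encode (x, mso_code \<alpha>))"
| "mso_code (MAll2 X \<alpha>) = prod_encode (9, prod_encode (X, mso_code \<alpha>))"
| "mso_code (MEx2 X \<alpha>) = prod_encode (10, prod_encode (X, mso_code \<alpha>))"

lemma inj_ipc2_code: "inj ipc2_code"
proof (rule injI)
  show "\<phi> = \<psi>" if "ipc2_code \<phi> = ipc2_code \<psi>" for \<phi> \<psi>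
    using that
    by (induction \<phi> arbitrary: \<psi>) (case_tac \<psi>; simp add: prod_encode_eq)+
qed

lemma inj_term_code: "inj term_code"
proof (rule injI)
  show "s = t" if "term_code s = term_code t" for s t
    using that
    by (induction s arbitrary: t) (case_tac t; simp add: prod_encode_eq)+
qed

lemma inj_mso_code: "inj mso_code"
proof (rule injI)
  show "\<alpha> = \<beta>" if "mso_code \<alpha> = mso_code \<beta>" for \<alpha> \<beta>
    using that
    by (induction \<alpha> arbitrary: \<beta>)
       (case_tac \<beta>; simp add: prod_encode_eq inj_eq[OF inj_term_code])+
qed

text \<open>A map defined on sentences; since the set of codes of sentences is decidable, it makes no
  difference that the recursive function is total on the natural numbers.\<close>

definition computable_translation :: "(ipc2 \<Rightarrow> mso) \<Rightarrow> bool" where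
  "computable_translation t \<longleftrightarrow>
     (\<exists>F. computable_nat F \<and> (\<forall>\<phi>. ipc2_sentence \<phi> \<longrightarrow> F (ipc2_code \<phi>) = mso_code (t \<phi>)))"

end

theory Submission imports Defs begin

text \<open>
  The nodes of the binary tree, in their in-order, form a copy of the rationals, and this order is
  definable from \<open>\<le>\<close>.  A real is therefore coded by its lower cut, a set of nodes.  Every closed
  subset of the line is the derived set of a set of rationals, so a single set of nodes codes an
  open set, and membership says that some interval around the point contains at most one of these
  nodes.  The clauses of the topological semantics then turn into quantification over sets of
  nodes.  The translation for the rationals differs only in the formula that singles out the points:
  there the cut must be the one below a node.
\<close>

section \<open>The binary tree as the ordered set of rationals\<close>

text \<open>An order isomorphism of the line onto the positive half-line: \<open>x + 1\<close>
  covers [1, infinity) and \<open>1 / (1 - x)\<close> covers (0, 1). Both pieces and their inverses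
  preserve rationality.\<close>

definition right_half :: "real \<Rightarrow> real" where
  "right_half x = (if x \<ge> 0 then x + 1 else 1 / (1 - x))"

text \<open>Recursion on the first letter makes the right subtree of the root a copy of the whole
  tree carried to the positive half-line, and the left subtree one carried to the negative
  half-line.\<close>

primrec tree_rat :: "bool list \<Rightarrow> real" where
  "tree_rat [] = 0"
| "tree_rat (b # w) = (if b then right_half (tree_rat w) else - right_half (- tree_rat w))"

lemma right_half_pos: "right_half x > 0"
  by (auto simp: right_half_def)

lemma right_half_less_iff: "right_half x < right_half y \<longleftrightarrow> x < y"
proof -
  have less: "right_half x < right_half y" if "x < y" for x y
  proof -
    consider "x \<ge> 0" | "x < 0" "y \<ge> 0" | "y < 0" by linarith
    then show ?thesis
    proof cases
      case 2
      then have "1 / (1 - x) < 1" by simp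
      with 2 have "1 / (1 - x) < y + 1" by linarith
      then show ?thesis using 2 by (simp add: right_half_def)
    next
      case 3
      then show ?thesis using that by (simp add: right_half_def frac_less2)
    qed (use that in \<open>simp add: right_half_def\<close>)
  qed
  show ?thesis
    using less[of x y] less[of y x] by (metis less_asym linorder_neqE_linordered_idom less_irrefl)
qed

lemma tree_rat_in_Rats: "tree_rat w \<in> \<rat>"
  by (induction w) (auto simp: right_half_def)

text \<open>Subtractive Euclidean algorithm: the preimage of \<open>a / b\<close> under
  \<open>right_half\<close> is \<open>(a - b) / b\<close> or \<open>- ((b - a) / a)\<close>. Since
  the sign may change, both signs go through one induction.\<close>

lemma tree_rat_surj_pos:
  fixes a b :: nat
  assumes "b > 0"
  shows "\<exists>w. tree_rat w = real a / real b" "\<exists>w. tree_rat w = - (real a / real b)"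
proof -
  have "(\<exists>w. tree_rat w = real a / real b) \<and> (\<exists>w. tree_rat w = - (real a / real b))"
    using assms
  proof (induction "a + b" arbitrary: a b rule: less_induct)
    case less
    consider "a = 0" | "a > 0" "b \<le> a" | "a > 0" "a < b" by linarith
    then show ?case
    proof cases
      case 1
      moreover have "tree_rat [] = 0" by simp
      ultimately show ?thesis by (metis div_0 minus_zero of_nat_0)
    next
      case 2
      have "(a - b) + b < a + b" using less.prems 2 by simp
      from less.hyps[OF this less.prems]
      obtain u v where "tree_rat u = real (a - b) / real b" "tree_rat v = - (real (a - b) / real b)"
        by blast
      moreover have "right_half (real (a - b) / real b) = real a / real b"
        using 2 less.prems by (simp add: right_half_def of_nat_diff field_simps)
      ultimately have "tree_rat (True # u) = real a / real b"
        "tree_rat (False # v) = - (real a / real b)"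
        by auto
      then show ?thesis by blast
    next
      case 3
      have "(b - a) + a < a + b" using 3 by simp
      from less.hyps[OF this 3(1)]
      obtain u v where "tree_rat u = real (b - a) / real a" "tree_rat v = - (real (b - a) / real a)"
        by blast
      moreover have "right_half (- (real (b - a) / real a)) = real a / real b"
        using 3 by (simp add: right_half_def of_nat_diff field_simps)
      ultimately have "tree_rat (True # v) = real a / real b"
        "tree_rat (False # u) = - (real a / real b)"
        by auto
      then show ?thesis by blast
    qed
  qed
  then show "\<exists>w. tree_rat w = real a / real b" "\<exists>w. tree_rat w = - (real a / real b)"
    by auto
qed

lemma range_tree_rat: "range tree_rat = \<rat>"
proof
  show "range tree_rat \<subseteq> \<rat>" using tree_rat_in_Rats by auto
  show "\<rat> \<subseteq> range tree_rat"
  proof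
    fix q :: real assume "q \<in> \<rat>"
    then obtain a b :: nat where "b \<noteq> 0" "\<bar>q\<bar> = real a / real b"
      by (rule Rats_abs_nat_div_natE)
    then show "q \<in> range tree_rat"
      using tree_rat_surj_pos[of b a] by (metis abs_if minus_minus neq0_conv rangeI)
  qed
qed

text \<open>This makes the order of the rationals definable in the tree: \<open>x\<close> is the
  node where the paths to \<open>u\<close> and \<open>w\<close> part, and either path may end
  there.\<close>

lemma tree_rat_less_iff:
  "tree_rat u < tree_rat w \<longleftrightarrow>
     (\<exists>x. (prefix (x @ [False]) u \<or> x = u) \<and> (prefix (x @ [True]) w \<or> x = w) \<and> u \<noteq> w)"
proof (induction u arbitrary: w)
  case Nil
  show ?case
    by (cases w) (auto simp: right_half_pos less_imp_le not_less)
next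
  case (Cons b u)
  have neg: "- right_half s < right_half t" "\<not> right_half s < - right_half t" for s t
    using right_half_pos[of s] right_half_pos[of t] by linarith+
  \<comment> \<open>The separating node is either the root or lies below it; in the second case both
    words share a first letter, and stripping it leads to the induction hypothesis.\<close>
  have ex_list: "(\<exists>x. P x) \<longleftrightarrow> P [] \<or> (\<exists>d x. P (d # x))" for P :: "bool list \<Rightarrow> bool"
    by (metis neq_Nil_conv)
  show ?case
  proof (cases w)
    case Nil
    then show ?thesis
      using right_half_pos[of "tree_rat u"] right_half_pos[of "- tree_rat u"]
      by (subst ex_list) (auto simp: less_imp_le not_less)
  next
    case w: (Cons c w')
    then show ?thesis
      using Cons.IH[of w']
      by (subst ex_list) (cases b; cases c; auto simp: neg right_half_less_iff)
  qed
qed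

lemma inj_tree_rat: "inj tree_rat"
proof (rule injI)
  show "u = w" if "tree_rat u = tree_rat w" for u w
    using that
  proof (induction u arbitrary: w)
    case Nil
    then show ?case
      using right_half_pos by (cases w) (auto simp: less_le split: if_splits)
  next
    case (Cons b u)
    have "right_half s = right_half t \<longleftrightarrow> s = t" for s t
      by (metis less_irrefl linorder_neqE_linordered_idom right_half_less_iff)
    moreover have "right_half s \<noteq> - right_half t" "- right_half s \<noteq> right_half t"
      "right_half s \<noteq> 0" for s t
      using right_half_pos[of s] right_half_pos[of t] by linarith+
    ultimately show ?case
      using Cons by (cases w) (auto split: if_splits)
  qed
qed

section \<open>Coding points and open sets of the real line\<close>

text \<open>The inequality is strict so that no cut has a greatest node, whether the real is
  rational or not.\<close>

definition lower_cut :: "real \<Rightarrow> bool list set" where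
  "lower_cut x = {w. tree_rat w < x}"

definition coded_open :: "bool list set \<Rightarrow> real set" where
  "coded_open A = {x. \<not> x islimpt (tree_rat ` A)}"

lemma ex_tree_rat_between:
  assumes "x < y"
  shows "\<exists>w. x < tree_rat w \<and> tree_rat w < y"
  using Rats_dense_in_real[OF assms] unfolding range_tree_rat[symmetric] by auto

text \<open>Dedekind completeness. The last conjunct packs two conditions: from right to left
  \<open>X\<close> is closed downwards, from left to right it has no greatest node.\<close>

lemma ex_real_lower_cut_iff:
  "(\<exists>x. X = lower_cut x) \<longleftrightarrow>
     (\<exists>w. w \<in> X) \<and> (\<exists>w. w \<notin> X) \<and> (\<forall>w. w \<in> X \<longleftrightarrow> (\<exists>u. tree_rat w < tree_rat u \<and> u \<in> X))"
    (is "?L \<longleftrightarrow> ?R")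
proof
  assume ?L
  then obtain x where X: "X = lower_cut x" by blast
  obtain u w where "tree_rat u < x" "x < tree_rat w"
    using ex_tree_rat_between[of "x - 1" x] ex_tree_rat_between[of x "x + 1"] by auto
  moreover have "w \<in> lower_cut x \<longleftrightarrow> (\<exists>u. tree_rat w < tree_rat u \<and> u \<in> lower_cut x)" for w
    using ex_tree_rat_between[of "tree_rat w" x] by (auto simp: lower_cut_def)
  ultimately show ?R
    unfolding X by (metis lower_cut_def mem_Collect_eq order.asym)
next
  assume R: ?R
  then obtain a b where a: "a \<in> X" and b: "b \<notin> X" by blast
  have below: "w \<in> X" if "tree_rat w < tree_rat u" "u \<in> X" for u w
    using R that by blast
  have upper: "tree_rat w \<le> tree_rat b" if "w \<in> X" for w
    using below[OF _ that, of b] b by (meson not_le)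
  \<comment> \<open>The supremum exists because \<open>a\<close> is in \<open>X\<close> and
    \<open>b\<close> bounds it; it is not attained, as \<open>X\<close> has no greatest
    node.\<close>
  define x where "x = Sup (tree_rat ` X)"
  have bdd: "bdd_above (tree_rat ` X)"
    using upper by (auto simp: bdd_above_def)
  have "w \<in> X \<longleftrightarrow> tree_rat w < x" for w
  proof
    assume "w \<in> X"
    then obtain u where "tree_rat w < tree_rat u" "u \<in> X" using R by blast
    then show "tree_rat w < x"
      unfolding x_def using bdd by (meson cSup_upper imageI less_le_trans)
  next
    assume "tree_rat w < x"
    then obtain u where "u \<in> X" "tree_rat w < tree_rat u"
      unfolding x_def using a less_cSupD[of "tree_rat ` X" "tree_rat w"] by blast
    then show "w \<in> X" using below by blast
  qed
  then show ?L by (auto simp: lower_cut_def)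
qed

lemma ex_rat_lower_cut_iff:
  "(\<exists>x\<in>\<rat>. X = lower_cut x) \<longleftrightarrow> (\<exists>u. \<forall>w. w \<in> X \<longleftrightarrow> tree_rat w < tree_rat u)"
  unfolding range_tree_rat[symmetric] by (auto simp: lower_cut_def)

section \<open>Open sets and their codes\<close>

lemma open_coded_open: "open (coded_open A)"
proof -
  have "coded_open A = - {x. x islimpt tree_rat ` A}"
    by (auto simp: coded_open_def)
  then show ?thesis
    using closed_limpts by (simp add: open_closed)
qed

text \<open>The complement \<open>F\<close> of an open set is the derived set of those fractions \<open>k / n\<close>
  whose distance to \<open>F\<close> is less than \<open>2 / n\<close>.\<close>

lemma ex_coded_open:
  assumes "open U"
  shows "\<exists>A. coded_open A = U"
proof -
  define B where "B = {of_int k / real n | k n. n > 0 \<and> (\<exists>f. f \<notin> U \<and> \<bar>of_int k / real n - f\<bar> < 2 / real n)}"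
  define A where "A = tree_rat -` B"
  have "B \<subseteq> \<rat>" by (auto simp: B_def)
  then have A: "tree_rat ` A = B"
    using range_tree_rat unfolding A_def by (metis image_vimage_eq inf.absorb_iff1)
  have "x islimpt B \<longleftrightarrow> x \<notin> U" for x
  proof
    assume "x \<notin> U"
    show "x islimpt B"
      unfolding islimpt_approachable
    proof (intro allI impI)
      fix e :: real assume "e > 0"
      obtain n :: nat where "2 / e < real n" using reals_Archimedean2 by blast
      moreover have "2 / e > 0" using \<open>e > 0\<close> by simp
      ultimately have n: "n > 0" "2 / real n < e"
        using \<open>e > 0\<close>
        by (metis less_trans of_nat_0_less_iff, metis divide_less_eq less_trans mult.commute)
      have near: "of_int k / real n \<in> B \<and> dist (of_int k / real n) x < e"
        if "\<bar>of_int k - x * real n\<bar> < 2" for k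
      proof -
        have "\<bar>of_int k / real n - x\<bar> = \<bar>of_int k - x * real n\<bar> / real n"
          using n by (simp add: field_simps abs_divide[symmetric] flip: abs_mult)
        also have "\<dots> < 2 / real n"
          using that n by (simp add: divide_strict_right_mono)
        finally have "\<bar>of_int k / real n - x\<bar> < 2 / real n" .
        then show ?thesis
          using \<open>x \<notin> U\<close> n unfolding B_def dist_real_def by fastforce
      qed
      \<comment> \<open>A limit point needs a nearby element other than \<open>x\<close>. Two
        distinct fractions with denominator \<open>n\<close> are near \<open>x\<close>, so one of
        them differs from \<open>x\<close> even if \<open>x\<close> is such a fraction.\<close>
      let ?k = "\<lfloor>x * real n\<rfloor>"
      have "\<bar>of_int ?k - x * real n\<bar> < 2" "\<bar>of_int (?k + 1) - x * real n\<bar> < 2"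
        by linarith+
      moreover have "of_int ?k / real n \<noteq> of_int (?k + 1) / real n"
        using n by simp
      ultimately show "\<exists>y\<in>B. y \<noteq> x \<and> dist y x < e"
        using near by metis
    qed
  next
    assume lim: "x islimpt B"
    show "x \<notin> U"
    proof
      assume "x \<in> U"
      then obtain d where "d > 0" "ball x d \<subseteq> U"
        using assms unfolding open_contains_ball by blast
      \<comment> \<open>Points outside \<open>U\<close> are at least \<open>2 * e\<close> away from
        \<open>x\<close>, hence more than \<open>e\<close> away from any \<open>y\<close> within
        \<open>e\<close> of \<open>x\<close>. So an element of \<open>B\<close> that close to
        \<open>x\<close> has a denominator below \<open>2 / e\<close>, and its numerator is bounded
        too: only finitely many remain.\<close>
      then obtain e where e: "e > 0" "ball x (2 * e) \<subseteq> U"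
        using that[of "d / 2"] by simp
      obtain N :: nat where N: "2 / e < real N" using reals_Archimedean2 by blast
      define K where "K = \<lceil>(\<bar>x\<bar> + e) * real N\<rceil>"
      have "B \<inter> ball x e \<subseteq> (\<lambda>(k, n). of_int k / real n) ` ({-K..K} \<times> {..N})"
      proof
        fix y assume "y \<in> B \<inter> ball x e"
        then obtain k n f where y: "y = of_int k / real n" "n > 0" "f \<notin> U" "\<bar>y - f\<bar> < 2 / real n"
          "\<bar>x - y\<bar> < e"
          unfolding B_def by (auto simp: dist_real_def)
        have "\<not> \<bar>x - f\<bar> < 2 * e"
          using e y(3) by (auto simp: dist_real_def subset_iff)
        then have "e < 2 / real n" using y(4,5) by linarith
        then have "real n < 2 / e" using y(2) e(1) by (simp add: field_simps)
        then have n: "n \<le> N" using N by linarith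
        have "\<bar>of_int k\<bar> = \<bar>y\<bar> * real n" using y(1,2) by simp
        also have "\<dots> \<le> (\<bar>x\<bar> + e) * real N"
          using y(5) n by (intro mult_mono) auto
        finally have "\<bar>k\<bar> \<le> K" unfolding K_def by linarith
        then show "y \<in> (\<lambda>(k, n). of_int k / real n) ` ({-K..K} \<times> {..N})"
          using n y(1) by (intro image_eqI[of _ _ "(k, n)"]) auto
      qed
      then have "finite (B \<inter> ball x e)" by (rule finite_subset) auto
      then show False using lim e(1) by (simp add: islimpt_eq_infinite_ball)
    qed
  qed
  then have "coded_open A = U" by (auto simp: coded_open_def A)
  then show ?thesis by blast
qed

text \<open>An interval with nodes as ends is what a formula can speak of. Non-membership of
  \<open>r'\<close> gives only \<open>x \<le> tree_rat r'\<close>, so the larger \<open>r\<close> is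
  there to make the right end strict. One exception \<open>c\<close> is allowed because
  \<open>x\<close> itself may be an isolated point of the coding set.\<close>

lemma mem_coded_open_iff:
  "x \<in> coded_open A \<longleftrightarrow>
     (\<exists>q\<in>lower_cut x. \<exists>r' r c. r' \<notin> lower_cut x \<and> tree_rat r' < tree_rat r \<and>
        (\<forall>s\<in>A. tree_rat q < tree_rat s \<and> tree_rat s < tree_rat r \<longrightarrow> s = c))"
    (is "_ \<longleftrightarrow> ?R")
proof
  assume "x \<in> coded_open A"
  then obtain e where e: "e > 0" "\<And>y. y \<in> tree_rat ` A \<Longrightarrow> y \<noteq> x \<Longrightarrow> \<not> dist y x < e"
    unfolding coded_open_def islimpt_approachable by blast
  obtain q r' where "x - e < tree_rat q" "tree_rat q < x" "x < tree_rat r'" "tree_rat r' < x + e"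
    using ex_tree_rat_between[of "x - e" x] ex_tree_rat_between[of x "x + e"] e(1) by auto
  moreover obtain r where "tree_rat r' < tree_rat r" "tree_rat r < x + e"
    using ex_tree_rat_between calculation(4) by blast
  ultimately have between: "x - e < tree_rat q" "tree_rat q < x" "x < tree_rat r'"
    "tree_rat r' < tree_rat r" "tree_rat r < x + e" by auto
  \<comment> \<open>For rational \<open>x\<close> this is its node. For irrational \<open>x\<close>
    it is an arbitrary node, and the claim is vacuous because no \<open>s\<close> has the value
    \<open>x\<close>.\<close>
  moreover have "s = inv tree_rat x"
    if "s \<in> A" "tree_rat q < tree_rat s" "tree_rat s < tree_rat r" for s
  proof -
    have "dist (tree_rat s) x < e"
      using between that unfolding dist_real_def by linarith
    then have "tree_rat s = x" using e(2) that(1) by blast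
    then show ?thesis using inj_tree_rat by auto
  qed
  ultimately show ?R
    unfolding lower_cut_def by (intro bexI[of _ q] exI[of _ r'] exI[of _ r] exI[of _ "inv tree_rat x"]) auto
next
  assume ?R
  then obtain q r' r c where "tree_rat q < x" "x \<le> tree_rat r'" "tree_rat r' < tree_rat r"
    and c: "\<And>s. s \<in> A \<Longrightarrow> tree_rat q < tree_rat s \<Longrightarrow> tree_rat s < tree_rat r \<Longrightarrow> s = c"
    unfolding lower_cut_def mem_Collect_eq not_less by blast
  then have "x \<in> {tree_rat q<..<tree_rat r}" by simp
  moreover have "tree_rat ` A \<inter> {tree_rat q<..<tree_rat r} \<subseteq> {tree_rat c}"
    using c by auto
  then have "finite (tree_rat ` A \<inter> {tree_rat q<..<tree_rat r})"
    using finite_subset by blast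
  ultimately have "\<not> x islimpt (tree_rat ` A)"
    unfolding islimpt_eq_acc_point using open_greaterThanLessThan Int_commute by metis
  then show "x \<in> coded_open A" by (simp add: coded_open_def)
qed

text \<open>Every set of nodes is a code, so a quantifier over relatively open sets becomes an
  unguarded set quantifier.\<close>

lemma openin_top_of_set_iff: "openin (top_of_set S) V \<longleftrightarrow> (\<exists>A. V = S \<inter> coded_open A)"
  by (metis ex_coded_open open_coded_open openin_open)

section \<open>The translation\<close>

text \<open>The variable \<open>9\<close> is reserved for the node at which the paths to \<open>x\<close> and \<open>y\<close>
  separate, see \<open>tree_rat_less_iff\<close>.\<close>

definition mso_less :: "nat \<Rightarrow> nat \<Rightarrow> mso" where
  "mso_less x y =
     MEx1 9 (MAnd (MAnd (MOr (MLeq (TS0 (TVar 9)) (TVar x)) (MEq (TVar 9) (TVar x)))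
                        (MOr (MLeq (TS1 (TVar 9)) (TVar y)) (MEq (TVar 9) (TVar y))))
                  (MNot (MEq (TVar x) (TVar y))))"

definition mso_iff :: "mso \<Rightarrow> mso \<Rightarrow> mso" where
  "mso_iff \<alpha> \<beta> = MAnd (MImp \<alpha> \<beta>) (MImp \<beta> \<alpha>)"

definition real_point :: mso where
  "real_point =
     MAnd (MEx1 0 (MMem (TVar 0) 0)) (MAnd (MEx1 0 (MNot (MMem (TVar 0) 0)))
       (MAll1 0 (mso_iff (MMem (TVar 0) 0) (MEx1 1 (MAnd (mso_less 0 1) (MMem (TVar 1) 0))))))"

definition rat_point :: mso where
  "rat_point = MEx1 0 (MAll1 1 (mso_iff (MMem (TVar 1) 0) (mso_less 1 0)))"

text \<open>Transcribes \<open>mem_coded_open_iff\<close>: the element variables 0, 1, 2, 3, 4 stand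
  for \<open>q\<close>, \<open>r'\<close>, \<open>r\<close>, \<open>c\<close>,
  \<open>s\<close>.\<close>

definition mem_open :: "nat \<Rightarrow> mso" where
  "mem_open X =
     MEx1 0 (MAnd (MMem (TVar 0) 0) (MEx1 1 (MEx1 2 (MEx1 3
       (MAnd (MNot (MMem (TVar 1) 0)) (MAnd (mso_less 1 2)
         (MAll1 4 (MImp (MMem (TVar 4) X)
            (MImp (MAnd (mso_less 0 4) (mso_less 4 2)) (MEq (TVar 4) (TVar 3))))))))))) "

text \<open>Rebinding set variable 0 evaluates \<open>\<alpha>\<close> at the other points of the
  neighbourhood; \<open>P\<close> keeps them inside the space.\<close>

definition mso_interior :: "mso \<Rightarrow> mso \<Rightarrow> mso" where
  "mso_interior P \<alpha> = MEx2 1 (MAnd (mem_open 1) (MAll2 0 (MImp (MAnd P (mem_open 1)) \<alpha>)))"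

text \<open>The set variable \<open>0\<close> holds the point at which a formula is evaluated, \<open>1\<close> a neighbourhood
  of it, and \<open>p + 2\<close> the value of the propositional variable \<open>p\<close>.\<close>

primrec mso_trans :: "mso \<Rightarrow> ipc2 \<Rightarrow> mso" where
  "mso_trans P (IVar p) = mem_open (p + 2)"
| "mso_trans P IBot = MEx1 0 (MNot (MEq (TVar 0) (TVar 0)))"
| "mso_trans P (IAnd \<psi> \<gamma>) = MAnd (mso_trans P \<psi>) (mso_trans P \<gamma>)"
| "mso_trans P (IOr \<psi> \<gamma>) = MOr (mso_trans P \<psi>) (mso_trans P \<gamma>)"
| "mso_trans P (IImp \<psi> \<gamma>) = mso_interior P (MImp (mso_trans P \<psi>) (mso_trans P \<gamma>))"
| "mso_trans P (IAll p \<psi>) = mso_interior P (MAll2 (p + 2) (mso_trans P \<psi>))"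
| "mso_trans P (IEx p \<psi>) = MEx2 (p + 2) (mso_trans P \<psi>)"

definition mso_truth :: "mso \<Rightarrow> ipc2 \<Rightarrow> mso" where
  "mso_truth P \<phi> = MAll2 0 (MImp P (mso_trans P \<phi>))"

section \<open>Correctness of the translation\<close>

lemma sat_mso_less:
  assumes "x \<noteq> 9" "y \<noteq> 9"
  shows "mso_sat binary_tree e E (mso_less x y) \<longleftrightarrow> tree_rat (e x) < tree_rat (e y)"
  using assms unfolding tree_rat_less_iff by (auto simp: mso_less_def binary_tree_def)

lemma sat_real_point: "mso_sat binary_tree e E real_point \<longleftrightarrow> (\<exists>x\<in>UNIV. E 0 = lower_cut x)"
  unfolding bex_UNIV ex_real_lower_cut_iff by (simp add: real_point_def mso_iff_def sat_mso_less) blast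

lemma sat_rat_point: "mso_sat binary_tree e E rat_point \<longleftrightarrow> (\<exists>x\<in>\<rat>. E 0 = lower_cut x)"
  unfolding ex_rat_lower_cut_iff by (simp add: rat_point_def mso_iff_def sat_mso_less) blast

lemma sat_mem_open:
  assumes "E 0 = lower_cut x"
  shows "mso_sat binary_tree e E (mem_open X) \<longleftrightarrow> x \<in> coded_open (E X)"
  unfolding mem_coded_open_iff by (simp add: mem_open_def sat_mso_less assms Ball_def Bex_def)

lemma ipc2_val_subset_topspace:
  "(\<And>p. v p \<subseteq> topspace T) \<Longrightarrow> ipc2_val T v \<phi> \<subseteq> topspace T"
proof (induction \<phi> arbitrary: v)
  case (IEx p \<psi>)
  have "ipc2_val T (v(p := a)) \<psi> \<subseteq> topspace T" if "openin T a" for a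
    by (rule IEx.IH) (use IEx.prems openin_subset[OF that] in auto)
  then show ?case by auto
qed (auto simp: interior_of_subset_topspace[THEN subsetD])

text \<open>One correctness proof serves both spaces: \<open>S\<close> is the set of points and
  \<open>P\<close> the formula recognizing their cuts.\<close>

context
  fixes P :: mso and S :: "real set"
  assumes sat_P: "\<And>e E. mso_sat binary_tree e E P \<longleftrightarrow> (\<exists>x\<in>S. E 0 = lower_cut x)"
begin

text \<open>Shared by implication and universal quantification, the two clauses with an interior.
  \<open>Z\<close> must not depend on \<open>A\<close>: the truth of \<open>\<alpha>\<close> may
  vary only with the point.\<close>

lemma sat_interior:
  assumes "E 0 = lower_cut x" "x \<in> S"
    and \<alpha>: "\<And>y A. y \<in> S \<Longrightarrow> mso_sat binary_tree e (E(1 := A, 0 := lower_cut y)) \<alpha> \<longleftrightarrow> y \<in> Z"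
  shows "mso_sat binary_tree e E (mso_interior P \<alpha>) \<longleftrightarrow> x \<in> top_of_set S interior_of Z"
proof -
  have mem: "mso_sat binary_tree e (E(1 := A, 0 := lower_cut y)) (mem_open 1) \<longleftrightarrow> y \<in> coded_open A" for A y
    by (subst sat_mem_open[where x = y]) auto
  have "x \<in> top_of_set S interior_of Z \<longleftrightarrow> (\<exists>A. x \<in> coded_open A \<and> S \<inter> coded_open A \<subseteq> Z)"
    unfolding interior_of_def openin_top_of_set_iff using assms(2) by auto
  also have "\<dots> \<longleftrightarrow> (\<exists>A. x \<in> coded_open A \<and> (\<forall>y\<in>S. y \<in> coded_open A \<longrightarrow>
                        mso_sat binary_tree e (E(1 := A, 0 := lower_cut y)) \<alpha>))"
    using \<alpha> by blast
  \<comment> \<open>Points are replaced by their cuts, which turns the quantifier over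
    \<open>S\<close> into a set quantifier guarded by \<open>P\<close>.\<close>
  also have "\<dots> \<longleftrightarrow> (\<exists>A. x \<in> coded_open A \<and> (\<forall>Y. (\<exists>y\<in>S. Y = lower_cut y) \<and>
      mso_sat binary_tree e (E(1 := A, 0 := Y)) (mem_open 1) \<longrightarrow>
                        mso_sat binary_tree e (E(1 := A, 0 := Y)) \<alpha>))"
    unfolding mem[symmetric] by blast
  finally show ?thesis
    by (simp add: mso_interior_def sat_P sat_mem_open assms(1))
qed

text \<open>The valuation is read off the set variables from 2 on. The induction generalizes
  \<open>E\<close> and \<open>x\<close> because interiors move the point and quantifiers change the
  valuation.\<close>

lemma sat_mso_trans:
  assumes "E 0 = lower_cut x" "x \<in> S"
  shows "mso_sat binary_tree e E (mso_trans P \<phi>) \<longleftrightarrow>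
           x \<in> ipc2_val (top_of_set S) (\<lambda>p. S \<inter> coded_open (E (p + 2))) \<phi>"
  using assms
proof (induction \<phi> arbitrary: E x)
  case (IVar p)
  then show ?case by (simp add: sat_mem_open)
next
  case (IImp \<psi> \<gamma>)
  show ?case
    unfolding mso_trans.simps ipc2_val.simps
    by (rule sat_interior[of E x e, OF IImp.prems]) (simp add: IImp.IH)
next
  case (IAll p \<psi>)
  \<comment> \<open>Changing set variable \<open>p + 2\<close> changes the valuation at
    \<open>p\<close>; the changes at 0 and 1 are invisible to it because of the shift by 2.\<close>
  have upd: "(\<lambda>q. S \<inter> coded_open (E (q + 2)))(p := S \<inter> coded_open A) =
    (\<lambda>q. S \<inter> coded_open ((E(1 := B, 0 := Y, p + 2 := A)) (q + 2)))" for A B Y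
    by (rule ext) simp
  show ?case
    unfolding mso_trans.simps ipc2_val.simps
  proof (rule sat_interior[of E x e, OF IAll.prems])
    fix y B assume "y \<in> S"
    then have "mso_sat binary_tree e (E(1 := B, 0 := lower_cut y, p + 2 := A)) (mso_trans P \<psi>) \<longleftrightarrow>
        y \<in> ipc2_val (top_of_set S) ((\<lambda>q. S \<inter> coded_open (E (q + 2)))(p := S \<inter> coded_open A)) \<psi>" for A
      unfolding upd[of A B "lower_cut y"] by (intro IAll.IH) auto
    then show "mso_sat binary_tree e (E(1 := B, 0 := lower_cut y)) (MAll2 (p + 2) (mso_trans P \<psi>)) \<longleftrightarrow>
       y \<in> (\<Inter>a\<in>{a. openin (top_of_set S) a}.
              ipc2_val (top_of_set S) ((\<lambda>q. S \<inter> coded_open (E (q + 2)))(p := a)) \<psi>)"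
      unfolding mso_sat.simps openin_top_of_set_iff by auto
  qed
next
  case (IEx p \<psi>)
  have upd: "(\<lambda>q. S \<inter> coded_open (E (q + 2)))(p := S \<inter> coded_open A) =
    (\<lambda>q. S \<inter> coded_open ((E(p + 2 := A)) (q + 2)))" for A
    by (rule ext) simp
  have "mso_sat binary_tree e (E(p + 2 := A)) (mso_trans P \<psi>) \<longleftrightarrow>
      x \<in> ipc2_val (top_of_set S) ((\<lambda>q. S \<inter> coded_open (E (q + 2)))(p := S \<inter> coded_open A)) \<psi>" for A
    unfolding upd by (rule IEx.IH) (use IEx.prems in auto)
  then show ?case
    unfolding mso_trans.simps mso_sat.simps ipc2_val.simps openin_top_of_set_iff by auto
qed auto

lemma models_mso_truth_iff:
  assumes "ipc2_sentence \<phi>"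
  shows "mso_models binary_tree (mso_truth P \<phi>) \<longleftrightarrow> ipc2_true_in (top_of_set S) \<phi>"
proof -
  have "mso_sat binary_tree e E (mso_truth P \<phi>) \<longleftrightarrow> ipc2_true_in (top_of_set S) \<phi>" for e E
  proof -
    \<comment> \<open>The truth of a sentence can be tested at any one valuation; this is the one
      that \<open>sat_mso_trans\<close> attaches to \<open>E\<close>.\<close>
    let ?v = "\<lambda>p. S \<inter> coded_open (E (p + 2))"
    have "mso_sat binary_tree e E (mso_truth P \<phi>) \<longleftrightarrow>
        (\<forall>x\<in>S. mso_sat binary_tree e (E(0 := lower_cut x)) (mso_trans P \<phi>))"
      by (auto simp: mso_truth_def sat_P)
    also have "\<dots> \<longleftrightarrow> S \<subseteq> ipc2_val (top_of_set S) ?v \<phi>"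
      using sat_mso_trans[of "E(0 := lower_cut _)"] by (auto simp: subset_iff)
    also have "\<dots> \<longleftrightarrow> ipc2_val (top_of_set S) ?v \<phi> = topspace (top_of_set S)"
      using ipc2_val_subset_topspace[of ?v "top_of_set S" \<phi>] by auto
    finally show ?thesis by (simp add: ipc2_true_in_sentence[OF assms, of _ ?v])
  qed
  then show ?thesis by (simp add: mso_models_def)
qed

end

section \<open>Free variables of the translation\<close>

lemma fv_points:
  "mso_fv1 real_point = {}" "mso_fv2 real_point = {0}"
  "mso_fv1 rat_point = {}" "mso_fv2 rat_point = {0}"
  by (auto simp: real_point_def rat_point_def mso_less_def mso_iff_def)

lemma fv_mem_open: "mso_fv1 (mem_open X) = {}" "mso_fv2 (mem_open X) = {0, X}"
  by (auto simp: mem_open_def mso_less_def)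

lemma mso_fv1_mso_trans: "mso_fv1 P = {} \<Longrightarrow> mso_fv1 (mso_trans P \<phi>) = {}"
  by (induction \<phi>) (auto simp: mso_interior_def fv_mem_open)

lemma mso_fv2_mso_trans:
  assumes "mso_fv2 P \<subseteq> {0}"
  shows "mso_fv2 (mso_trans P \<phi>) \<subseteq> insert 0 ((\<lambda>p. p + 2) ` ipc2_fv \<phi>)"
  using assms by (induction \<phi>) (auto simp: mso_interior_def fv_mem_open)

lemma mso_sentence_mso_truth:
  assumes "mso_fv1 P = {}" "mso_fv2 P \<subseteq> {0}" "ipc2_sentence \<phi>"
  shows "mso_sentence (mso_truth P \<phi>)"
  using assms mso_fv1_mso_trans[OF assms(1), of \<phi>] mso_fv2_mso_trans[OF assms(2), of \<phi>]
  by (auto simp: mso_sentence_def mso_truth_def ipc2_sentence_def)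

section \<open>Closure properties of recursive functions\<close>

text \<open>Unlike \<^const>\<open>general_recursive\<close>, this does not depend on the values at lists
  of the wrong length.\<close>

definition recursive_fun :: "nat \<Rightarrow> (nat list \<Rightarrow> nat) \<Rightarrow> bool" where
  "recursive_fun n f \<longleftrightarrow> (\<exists>f'. general_recursive n f' \<and> (\<forall>xs. length xs = n \<longrightarrow> f xs = f' xs))"

lemma recursive_funI:
  assumes "general_recursive n f'" "\<And>xs. length xs = n \<Longrightarrow> f xs = f' xs"
  shows "recursive_fun n f"
  using assms unfolding recursive_fun_def by blast

lemma recursive_fun_cong:
  assumes "recursive_fun n g" "\<And>xs. length xs = n \<Longrightarrow> f xs = g xs"
  shows "recursive_fun n f"
  using assms unfolding recursive_fun_def by metis

lemma recursive_fun_comp: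
  assumes "recursive_fun (length gs) f" "\<And>g. g \<in> set gs \<Longrightarrow> recursive_fun n g"
  shows "recursive_fun n (\<lambda>xs. f (map (\<lambda>g. g xs) gs))"
proof -
  obtain f' where f': "general_recursive (length gs) f'" "\<And>xs. length xs = length gs \<Longrightarrow> f xs = f' xs"
    using assms(1) unfolding recursive_fun_def by blast
  obtain h where h: "\<And>g. g \<in> set gs \<Longrightarrow> general_recursive n (h g)"
    "\<And>g xs. g \<in> set gs \<Longrightarrow> length xs = n \<Longrightarrow> g xs = h g xs"
    using assms(2) unfolding recursive_fun_def by metis
  show ?thesis
  proof (rule recursive_funI)
    show "general_recursive n (\<lambda>xs. f' (map (\<lambda>g. g xs) (map h gs)))"
      by (rule general_recursive.comp) (use f' h in auto)
    show "f (map (\<lambda>g. g xs) gs) = f' (map (\<lambda>g. g xs) (map h gs))" if "length xs = n" for xs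
    proof -
      have "map (\<lambda>g. g xs) gs = map (\<lambda>g. g xs) (map h gs)"
        using h(2) that by simp
      moreover have "f (map (\<lambda>g. g xs) gs) = f' (map (\<lambda>g. g xs) gs)"
        by (rule f'(2)) simp
      ultimately show ?thesis by metis
    qed
  qed
qed

lemma recursive_fun_comp1:
  assumes "recursive_fun 1 f" "recursive_fun n a"
  shows "recursive_fun n (\<lambda>xs. f [a xs])"
  using recursive_fun_comp[of "[a]" f n] assms by simp

lemma recursive_fun_comp3:
  assumes "recursive_fun 3 f" "recursive_fun n a" "recursive_fun n b" "recursive_fun n c"
  shows "recursive_fun n (\<lambda>xs. f [a xs, b xs, c xs])"
proof -
  have "recursive_fun n (\<lambda>xs. f (map (\<lambda>g. g xs) [a, b, c]))"
    by (rule recursive_fun_comp) (use assms in \<open>auto simp: numeral_3_eq_3\<close>)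
  then show ?thesis by simp
qed

lemma recursive_fun_nth: "i < n \<Longrightarrow> recursive_fun n (\<lambda>xs. xs ! i)"
  by (rule recursive_funI[OF general_recursive.proj]) auto

lemma recursive_fun_Suc: "recursive_fun n f \<Longrightarrow> recursive_fun n (\<lambda>xs. Suc (f xs))"
  using recursive_fun_comp1[OF recursive_funI[OF general_recursive.succ refl], of n f] by simp

lemma recursive_fun_const: "recursive_fun n (\<lambda>_. c)"
proof (induction c)
  case 0
  show ?case by (rule recursive_funI[OF general_recursive.zero]) simp
qed (rule recursive_fun_Suc)

text \<open>Weakening: the step function of a recursion receives counter and accumulator in front of
  the parameters and must skip them.\<close>

lemma recursive_fun_drop:
  assumes "recursive_fun n f"
  shows "recursive_fun (m + n) (\<lambda>xs. f (drop m xs))"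
proof (rule recursive_fun_cong)
  let ?gs = "map (\<lambda>i xs. xs ! (m + i)) [0..<n] :: (nat list \<Rightarrow> nat) list"
  show "recursive_fun (m + n) (\<lambda>xs. f (map (\<lambda>g. g xs) ?gs))"
    by (rule recursive_fun_comp) (use assms recursive_fun_nth in auto)
  show "f (drop m xs) = f (map (\<lambda>g. g xs) ?gs)" if "length xs = m + n" for xs
  proof -
    have "drop m xs = map (\<lambda>g. g xs) ?gs"
      using that by (intro nth_equalityI) auto
    then show ?thesis by simp
  qed
qed

lemma recursive_fun_Cons:
  assumes "recursive_fun (n + 1) f" "recursive_fun n c"
  shows "recursive_fun n (\<lambda>xs. f (c xs # xs))"
proof (rule recursive_fun_cong)
  let ?gs = "c # map (\<lambda>i xs. xs ! i) [0..<n]"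
  show "recursive_fun n (\<lambda>xs. f (map (\<lambda>g. g xs) ?gs))"
    by (rule recursive_fun_comp) (use assms recursive_fun_nth in auto)
  show "f (c xs # xs) = f (map (\<lambda>g. g xs) ?gs)" if "length xs = n" for xs
    using that map_nth[of xs] by (simp add: comp_def)
qed

text \<open>Primitive recursion runs on the head of the list; \<open>recursive_fun_Cons\<close> then
  puts the computed bound \<open>c xs\<close> there.\<close>

lemma recursive_fun_rec_nat:
  assumes "recursive_fun n a" "recursive_fun (n + 2) (\<lambda>ys. g (ys ! 0) (ys ! 1) (drop 2 ys))"
    "recursive_fun n c"
  shows "recursive_fun n (\<lambda>xs. rec_nat (a xs) (\<lambda>k r. g k r xs) (c xs))"
proof -
  obtain a' where a': "general_recursive n a'" "\<And>xs. length xs = n \<Longrightarrow> a xs = a' xs"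
    using assms(1) unfolding recursive_fun_def by blast
  obtain g' where g': "general_recursive (n + 2) g'"
    "\<And>xs. length xs = n + 2 \<Longrightarrow> g (xs ! 0) (xs ! 1) (drop 2 xs) = g' xs"
    using assms(2) unfolding recursive_fun_def by blast
  have "(\<lambda>k r. g k r xs) = (\<lambda>k r. g' (k # r # xs))" if "length xs = n" for xs
    using g'(2)[of "_ # _ # xs"] that by (intro ext) (simp add: numeral_2_eq_2)
  then have "recursive_fun (n + 1) (\<lambda>ys. rec_nat (a (tl ys)) (\<lambda>k r. g k r (tl ys)) (hd ys))"
    by (intro recursive_funI[OF general_recursive.prim_rec[OF a'(1) g'(1)]]) (simp add: a'(2))
  from recursive_fun_Cons[OF this assms(3)] show ?thesis by simp
qed

lemma recursive_fun_Least:
  assumes "recursive_fun (n + 1) (\<lambda>ys. f (ys ! 0) (tl ys))"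
    and "\<And>xs. length xs = n \<Longrightarrow> \<exists>y. f y xs = 0"
  shows "recursive_fun n (\<lambda>xs. LEAST y. f y xs = 0)"
proof -
  obtain f' where f': "general_recursive (n + 1) f'"
    "\<And>ys. length ys = n + 1 \<Longrightarrow> f (ys ! 0) (tl ys) = f' ys"
    using assms(1) unfolding recursive_fun_def by blast
  have "f y xs = f' (y # xs)" if "length xs = n" for y xs
    using f'(2)[of "y # xs"] that by simp
  then show ?thesis
    by (intro recursive_funI[OF general_recursive.minimize[OF f'(1)]]) (use assms(2) in auto)
qed

section \<open>Arithmetic, case distinction and the pairing function\<close>

lemma recursive_fun_add:
  assumes "recursive_fun n f" "recursive_fun n g"
  shows "recursive_fun n (\<lambda>xs. f xs + g xs)"
proof -
  have "rec_nat a (\<lambda>_. Suc) b = a + b" for a b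
    by (induction b) auto
  moreover have "recursive_fun n (\<lambda>xs. rec_nat (f xs) (\<lambda>k r. Suc r) (g xs))"
    by (intro recursive_fun_rec_nat assms recursive_fun_Suc recursive_fun_nth) simp
  ultimately show ?thesis by simp
qed

lemma recursive_fun_diff:
  assumes "recursive_fun n f" "recursive_fun n g"
  shows "recursive_fun n (\<lambda>xs. f xs - g xs)"
proof -
  have pred: "recursive_fun m (\<lambda>xs. h xs - 1)" if "recursive_fun m h" for m h
  proof -
    have "rec_nat 0 (\<lambda>k _. k) a = a - 1" for a :: nat by (cases a) auto
    moreover have "recursive_fun m (\<lambda>xs. rec_nat 0 (\<lambda>k r. k) (h xs))"
      by (intro recursive_fun_rec_nat that recursive_fun_const recursive_fun_nth) simp
    ultimately show ?thesis by simp
  qed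
  have "rec_nat a (\<lambda>_ r. r - 1) b = a - b" for a b :: nat by (induction b) auto
  moreover have "recursive_fun n (\<lambda>xs. rec_nat (f xs) (\<lambda>k r. r - 1) (g xs))"
    by (intro recursive_fun_rec_nat assms pred recursive_fun_nth) simp
  ultimately show ?thesis by simp
qed

text \<open>A recursion with a constant step tells zero rounds from a positive number of rounds, and
  \<open>(i - j) + (j - i)\<close> is zero exactly when \<open>i = j\<close>.\<close>

lemma recursive_fun_if_eq:
  assumes "recursive_fun n c" "recursive_fun n d" "recursive_fun n a" "recursive_fun n b"
  shows "recursive_fun n (\<lambda>xs. if c xs = d xs then a xs else b xs)"
proof -
  have "(if i = j then x else y) = rec_nat x (\<lambda>_ _. y) ((i - j) + (j - i))" for i j x y :: nat
  proof (cases "i = j")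
    case False
    then have "(i - j) + (j - i) \<noteq> 0" by simp
    then obtain m where "(i - j) + (j - i) = Suc m" using not0_implies_Suc by blast
    then show ?thesis using False by simp
  qed simp
  moreover have "recursive_fun (n + 2) (\<lambda>ys. b (drop 2 ys))"
    using recursive_fun_drop[OF assms(4), of 2] by (simp add: add.commute)
  then have "recursive_fun n (\<lambda>xs. rec_nat (a xs) (\<lambda>_ _. b xs) ((c xs - d xs) + (d xs - c xs)))"
    by (intro recursive_fun_rec_nat recursive_fun_add recursive_fun_diff assms)
  ultimately show ?thesis by simp
qed

lemma recursive_fun_triangle:
  assumes "recursive_fun n f"
  shows "recursive_fun n (\<lambda>xs. triangle (f xs))"
proof -
  have "rec_nat 0 (\<lambda>k r. r + Suc k) m = triangle m" for m by (induction m) auto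
  moreover have "recursive_fun n (\<lambda>xs. rec_nat 0 (\<lambda>k r. r + Suc k) (f xs))"
    by (intro recursive_fun_rec_nat assms recursive_fun_const recursive_fun_add recursive_fun_Suc
        recursive_fun_nth) auto
  ultimately show ?thesis by simp
qed

lemma recursive_fun_prod_encode:
  "recursive_fun n f \<Longrightarrow> recursive_fun n g \<Longrightarrow> recursive_fun n (\<lambda>xs. prod_encode (f xs, g xs))"
  by (simp add: prod_encode_def recursive_fun_add recursive_fun_triangle)

lemma triangle_mono: "m \<le> n \<Longrightarrow> triangle m \<le> triangle n"
  by (induction rule: dec_induct) auto

lemma less_triangle_Suc: "n < triangle (Suc n)"
  by (induction n) auto

text \<open>Unpairing by minimization: \<open>n\<close> encodes (a, b) as
  \<open>triangle (a + b) + a\<close>, and \<open>s\<close> is the diagonal a + b. With truncated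
  subtraction the condition says \<open>n < triangle (Suc y)\<close>.\<close>

lemma prod_decode_conv_Least:
  fixes n :: nat
  defines "s \<equiv> LEAST y. Suc n - triangle (Suc y) = 0"
  shows "prod_decode n = (n - triangle s, s - (n - triangle s))"
proof -
  obtain a b where ab: "prod_decode n = (a, b)" by fastforce
  then have n: "n = triangle (a + b) + a"
    using prod_decode_inverse[of n] by (simp add: prod_encode_def)
  have "s = a + b"
    unfolding s_def
  proof (rule Least_equality)
    show "a + b \<le> y" if "Suc n - triangle (Suc y) = 0" for y
    proof (rule ccontr)
      assume "\<not> a + b \<le> y"
      then have "triangle (Suc y) \<le> triangle (a + b)" by (intro triangle_mono) simp
      then show False using that n by simp
    qed
  qed (simp add: n)
  then show ?thesis using n ab by simp
qed

lemma recursive_fun_prod_decode: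
  assumes "recursive_fun n f"
  shows "recursive_fun n (\<lambda>xs. fst (prod_decode (f xs)))"
    and "recursive_fun n (\<lambda>xs. snd (prod_decode (f xs)))"
proof -
  have "recursive_fun 1 (\<lambda>xs. LEAST y. Suc (hd xs) - triangle (Suc y) = 0)"
  proof (rule recursive_fun_Least)
    have "recursive_fun 2 (\<lambda>ys. Suc (ys ! 1) - triangle (Suc (ys ! 0)))"
      by (intro recursive_fun_diff recursive_fun_Suc recursive_fun_triangle recursive_fun_nth) auto
    then show "recursive_fun (1 + 1) (\<lambda>ys. Suc (hd (tl ys)) - triangle (Suc (ys ! 0)))"
      unfolding one_add_one
      by (rule recursive_fun_cong) (auto simp: hd_conv_nth nth_tl tl_Nil numeral_2_eq_2 length_Suc_conv)
    show "\<exists>y. Suc (hd xs) - triangle (Suc y) = 0" for xs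
      using less_triangle_Suc[of "hd xs"] by (intro exI[of _ "hd xs"]) simp
  qed
  from recursive_fun_comp1[OF this assms]
  have "recursive_fun n (\<lambda>xs. LEAST y. Suc (f xs) - triangle (Suc y) = 0)" by simp
  then show "recursive_fun n (\<lambda>xs. fst (prod_decode (f xs)))"
    and "recursive_fun n (\<lambda>xs. snd (prod_decode (f xs)))"
    unfolding prod_decode_conv_Least fst_conv snd_conv
    by (intro recursive_fun_diff recursive_fun_triangle assms; assumption)+
qed

lemma computable_nat_iff: "computable_nat F \<longleftrightarrow> recursive_fun 1 (\<lambda>xs. F (xs ! 0))"
proof
  assume "computable_nat F"
  then obtain f where f: "general_recursive 1 f" "\<And>x. F x = f [x]"
    unfolding computable_nat_def by blast
  then show "recursive_fun 1 (\<lambda>xs. F (xs ! 0))"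
    by (intro recursive_funI[OF f(1)]) (auto simp: length_Suc_conv)
next
  assume "recursive_fun 1 (\<lambda>xs. F (xs ! 0))"
  then obtain f where f: "general_recursive 1 f" "\<And>xs. length xs = 1 \<Longrightarrow> F (xs ! 0) = f xs"
    unfolding recursive_fun_def by blast
  then show "computable_nat F"
    unfolding computable_nat_def using f(2)[of "[_]"] by auto
qed

lemma computable_nat_compose:
  assumes "computable_nat F" "recursive_fun n f"
  shows "recursive_fun n (\<lambda>xs. F (f xs))"
  using recursive_fun_comp1[OF assms(1)[unfolded computable_nat_iff] assms(2)] by simp

text \<open>The values \<open>F 0, \<dots>, F (n - 1)\<close> are stored as the nested pairs
  \<open>(F (n - 1), (F (n - 2), \<dots>))\<close>.\<close>

lemma course_of_values_recursion:
  assumes g: "recursive_fun 3 g" and l: "computable_nat l" and r: "computable_nat r"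
  obtains F where "computable_nat F"
    "\<And>n. \<exists>a b. F n = g [n, a, b] \<and> (l n < n \<longrightarrow> a = F (l n)) \<and> (r n < n \<longrightarrow> b = F (r n))"
proof -
  \<comment> \<open>The newest value comes first, so the value at \<open>c\<close> lies behind
    \<open>n - 1 - c\<close> tails. For \<open>c \<ge> n\<close> the truncated subtraction yields 0
    and the head is read, a value the conclusion leaves open.\<close>
  define entry where "entry n t c = fst (prod_decode (rec_nat t (\<lambda>_ t. snd (prod_decode t)) (n - 1 - c)))"
    for n t c
  define T where "T n = rec_nat 0 (\<lambda>k t. prod_encode (g [k, entry k t (l k), entry k t (r k)], t)) n" for n
  define F where "F n = fst (prod_decode (T (Suc n)))" for n
  have snd_T: "rec_nat (T n) (\<lambda>_ t. snd (prod_decode t)) j = T (n - j)" if "j \<le> n" for n j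
    using that
  proof (induction j)
    case (Suc j)
    then have "n - j = Suc (n - Suc j)" by simp
    then have "snd (prod_decode (T (n - j))) = T (n - Suc j)"
      by (simp only: T_def) simp
    then show ?case using Suc by simp
  qed simp
  have entry_T: "entry n (T n) c = F c" if "c < n" for n c
  proof -
    have "n - (n - 1 - c) = Suc c" using that by simp
    then show ?thesis using that by (simp add: entry_def snd_T F_def)
  qed
  have F: "F n = g [n, entry n (T n) (l n), entry n (T n) (r n)]" for n
    by (simp add: F_def T_def)
  have entry: "recursive_fun n (\<lambda>xs. entry (a xs) (t xs) (c xs))"
    if "recursive_fun n a" "recursive_fun n t" "recursive_fun n c" for n a t c
    unfolding entry_def
    by (intro recursive_fun_prod_decode recursive_fun_rec_nat recursive_fun_diff recursive_fun_const
        recursive_fun_nth that) auto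
  have T: "recursive_fun n (\<lambda>xs. T (f xs))" if "recursive_fun n f" for n f
    unfolding T_def
    by (intro recursive_fun_rec_nat recursive_fun_prod_encode recursive_fun_const that
        recursive_fun_comp3[OF g] entry recursive_fun_nth computable_nat_compose[OF l]
        computable_nat_compose[OF r]) auto
  show thesis
  proof
    show "computable_nat F"
      unfolding computable_nat_iff F_def
      by (intro recursive_fun_prod_decode T recursive_fun_Suc recursive_fun_nth) simp
  qed (use F entry_T in metis)
qed

section \<open>Computability of the translation\<close>

lemma recursive_fun_mem_open:
  "recursive_fun n f \<Longrightarrow> recursive_fun n (\<lambda>xs. mso_code (mem_open (f xs)))"
  unfolding mem_open_def mso_code.simps
  \<comment> \<open>With the constant rule tried first, only the branches of the code that contain
    \<open>f xs\<close> are taken apart.\<close>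
  by (rule recursive_fun_const | assumption | rule recursive_fun_prod_encode)+

text \<open>The action of \<open>mso_interior P\<close> on codes, since the recursion sees only the
  codes of translated components.\<close>

definition interior_code :: "mso \<Rightarrow> nat \<Rightarrow> nat" where
  "interior_code P c = prod_encode (10, prod_encode (1, prod_encode (4, prod_encode (mso_code (mem_open 1),
     prod_encode (9, prod_encode (0, prod_encode (6, prod_encode (mso_code (MAnd P (mem_open 1)), c))))))))"

lemma mso_code_interior: "mso_code (mso_interior P \<alpha>) = interior_code P (mso_code \<alpha>)"
  by (simp add: mso_interior_def interior_code_def)

lemma recursive_fun_interior_code:
  "recursive_fun n f \<Longrightarrow> recursive_fun n (\<lambda>xs. interior_code P (f xs))"
  unfolding interior_code_def
  by (rule recursive_fun_const | assumption | rule recursive_fun_prod_encode)+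

text \<open>The code of the translation of a formula with code \<open>n\<close>, given those of its two components;
  in the quantifier cases \<open>a\<close> is ignored, as the first component is then a variable.\<close>

definition trans_step :: "mso \<Rightarrow> nat \<Rightarrow> nat \<Rightarrow> nat \<Rightarrow> nat" where
  "trans_step P n a b =
     (let tag = fst (prod_decode n); arg = snd (prod_decode n);
          p = Suc (Suc (fst (prod_decode arg)))
      in if tag = 0 then mso_code (mem_open (Suc (Suc arg)))
         else if tag = 1 then mso_code (mso_trans P IBot)
         else if tag = 2 then prod_encode (4, prod_encode (a, b))
         else if tag = 3 then prod_encode (5, prod_encode (a, b))
         else if tag = 4 then interior_code P (prod_encode (6, prod_encode (a, b)))
         else if tag = 5 then interior_code P (prod_encode (9, prod_encode (p, b)))
         else prod_encode (10, prod_encode (p, b)))"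

lemma recursive_fun_trans_step:
  "recursive_fun 3 (\<lambda>xs. trans_step P (xs ! 0) (xs ! 1) (xs ! 2))"
  unfolding trans_step_def Let_def
  by (intro recursive_fun_if_eq recursive_fun_mem_open recursive_fun_interior_code
      recursive_fun_prod_encode recursive_fun_Suc recursive_fun_prod_decode recursive_fun_const
      recursive_fun_nth) auto

text \<open>Course-of-values recursion may look up only smaller arguments. Strictness comes from the
  positive tag: \<open>prod_encode (t, c)\<close> is \<open>triangle (t + c) + t\<close>, and
  \<open>triangle (t + c)\<close> is already at least \<open>c\<close>.\<close>

lemma less_prod_encode:
  assumes "0 < t"
  shows "a < prod_encode (t, prod_encode (a, b))" "b < prod_encode (t, prod_encode (a, b))"
proof -
  have "c < prod_encode (t, c)" for c
    using assms le_prod_encode_2[of c 0] triangle_mono[of c "t + c"]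
    by (simp add: prod_encode_def)
  then show "a < prod_encode (t, prod_encode (a, b))" "b < prod_encode (t, prod_encode (a, b))"
    using le_prod_encode_1 le_prod_encode_2 le_less_trans by blast+
qed

lemma computable_translation_mso_truth: "computable_translation (mso_truth P)"
proof -
  let ?l = "\<lambda>n. fst (prod_decode (snd (prod_decode n)))"
  let ?r = "\<lambda>n. snd (prod_decode (snd (prod_decode n)))"
  have "computable_nat ?l" "computable_nat ?r"
    unfolding computable_nat_iff by (intro recursive_fun_prod_decode recursive_fun_nth; simp)+
  from course_of_values_recursion[OF recursive_fun_trans_step[of P] this]
  obtain F where F: "computable_nat F" and
    "\<And>n. \<exists>a b. F n = trans_step P ([n, a, b] ! 0) ([n, a, b] ! 1) ([n, a, b] ! 2) \<and>
       (?l n < n \<longrightarrow> a = F (?l n)) \<and> (?r n < n \<longrightarrow> b = F (?r n))"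
    by blast
  then have F_step: "\<exists>a b. F n = trans_step P n a b \<and>
       (?l n < n \<longrightarrow> a = F (?l n)) \<and> (?r n < n \<longrightarrow> b = F (?r n))" for n
    by (simp add: numeral_2_eq_2)
  have step: "F (prod_encode (t, prod_encode (c, d))) =
      trans_step P (prod_encode (t, prod_encode (c, d))) (F c) (F d)" if "0 < t" for t c d
    using F_step[of "prod_encode (t, prod_encode (c, d))"] less_prod_encode[OF that] by auto
  have code: "F (ipc2_code \<phi>) = mso_code (mso_trans P \<phi>)" for \<phi>
  proof (induction \<phi>)
    case (IVar p)
    show ?case using F_step[of "prod_encode (0, p)"] by (auto simp: trans_step_def)
  next
    case IBot
    show ?case using F_step[of "prod_encode (1, 0)"] by (auto simp: trans_step_def)
  qed (use step in \<open>simp_all add: trans_step_def mso_code_interior\<close>)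
  \<comment> \<open>\<open>F\<close> computes the code of \<open>mso_trans\<close>; the tags 9 and 6
    add the prefix \<open>MAll2 0 (MImp P _)\<close> of \<open>mso_truth\<close>.\<close>
  let ?G = "\<lambda>n. prod_encode (9, prod_encode (0, prod_encode (6, prod_encode (mso_code P, F n))))"
  have "computable_nat ?G"
    unfolding computable_nat_iff
    by (intro recursive_fun_prod_encode recursive_fun_const computable_nat_compose[OF F]
        recursive_fun_nth) simp
  moreover have "?G (ipc2_code \<phi>) = mso_code (mso_truth P \<phi>)" for \<phi>
    by (simp add: mso_truth_def code)
  ultimately show ?thesis
    unfolding computable_translation_def by blast
qed

theorem mainTheorem1:
  "(\<exists>dagger :: ipc2 \<Rightarrow> mso. computable_translation dagger \<and>
      (\<forall>\<phi>. ipc2_sentence \<phi> \<longrightarrow>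
         mso_sentence (dagger \<phi>) \<and>
         (ipc2_true_in (euclidean :: real topology) \<phi> \<longleftrightarrow>
            mso_models binary_tree (dagger \<phi>)))) \<and>
   (\<exists>ddagger :: ipc2 \<Rightarrow> mso. computable_translation ddagger \<and>
      (\<forall>\<phi>. ipc2_sentence \<phi> \<longrightarrow>
         mso_sentence (ddagger \<phi>) \<and>
         (ipc2_true_in (top_of_set (\<rat> :: real set)) \<phi> \<longleftrightarrow>
            mso_models binary_tree (ddagger \<phi>))))"
proof (intro conjI exI allI impI)
  fix \<phi> assume \<phi>: "ipc2_sentence \<phi>"
  \<comment> \<open>The existential witnesses are still schematic here; these goals fix them as
    \<open>mso_truth real_point\<close> and \<open>mso_truth rat_point\<close>.\<close>
  show "mso_sentence (mso_truth real_point \<phi>)" "mso_sentence (mso_truth rat_point \<phi>)"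
    by (rule mso_sentence_mso_truth; simp add: fv_points \<phi>)+
  show "ipc2_true_in (euclidean :: real topology) \<phi> \<longleftrightarrow>
      mso_models binary_tree (mso_truth real_point \<phi>)"
    using models_mso_truth_iff[OF sat_real_point \<phi>] by simp
  show "ipc2_true_in (top_of_set (\<rat> :: real set)) \<phi> \<longleftrightarrow>
      mso_models binary_tree (mso_truth rat_point \<phi>)"
    using models_mso_truth_iff[OF sat_rat_point \<phi>] by simp
qed (rule computable_translation_mso_truth)+

end
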